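(* Let $G=(V,E)$ be a finite graph with $n$ vertices and maximum degree $\Delta$. Run the Persistent Decentralized Coloring algorithm on $G$ (random initial coloring, uniformly random choice of conflicted vertex, as described in the context). Then the algorithm terminates with a proper vertex coloring using colors from $\{1,\dots,\Delta+1\}$, and the expected total number of recolorings is $O(n\log\Delta)$.
   Context: A vertex $v$ is conflicted under a coloring $\chi$ if some neighbor $u$ of $v$ has $\chi(u)=\chi(v)$. The Persistent Decentralized Coloring algorithm maintains a coloring $\chi_t:V\to\{1,\dots,\Delta+1\}$: (1) initially each vertex independently chooses a uniformly random color from $\{1,\dots,\Delta+1\}$; (2) at each time step, a vertex $v$ is chosen uniformly at random among all currently conflicted vertices; (3) while $v$ is conflicted, $v$ repeatedly changes its color to an independent uniformly random color in $\{1,\dots,\Delta+1\}$ (each such change is one recoloring); (4) steps (2)–(3) repeat until no vertex is conflicted. The expectation is over the random initial coloring, the random choices of conflicted vertices, and the random new colors.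
   Formalization: The bound is proved as O(n log max(2,Δ)): for Δ ≥ 2 this is O(n log Δ), while for Δ ≤ 1 it reads O(n), since log Δ is 0 or undefined there and a single edge already needs one recoloring on average; termination is with probability 1. *)

theory Defs
  imports "HOL-Probability.Probability" "HOL-Probability.Product_PMF" "HOL-Probability.SPMF"
begin

type_synonym 'v edges = "'v set set"

definition simple_graph :: "'v set \<Rightarrow> 'v edges \<Rightarrow> bool" where
  "simple_graph V E \<longleftrightarrow> finite V \<and> E \<subseteq> {e. e \<subseteq> V \<and> card e = 2}"

definition nbrs :: "'v edges \<Rightarrow> 'v \<Rightarrow> 'v set" where
  "nbrs E v = {u. {u, v} \<in> E}"

text \<open>The inserted 0 only serves to give the graph without vertices maximum degree 0.\<close>

definition max_degree :: "'v set \<Rightarrow> 'v edges \<Rightarrow> nat" where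
  "max_degree V E = Max (insert 0 ((\<lambda>v. card (nbrs E v)) ` V))"

definition palette :: "'v set \<Rightarrow> 'v edges \<Rightarrow> nat set" where
  "palette V E = {1..max_degree V E + 1}"

definition proper_coloring :: "'v set \<Rightarrow> 'v edges \<Rightarrow> nat set \<Rightarrow> ('v \<Rightarrow> nat) \<Rightarrow> bool" where
  "proper_coloring V E C \<phi> \<longleftrightarrow>
     (\<forall>v\<in>V. \<phi> v \<in> C) \<and> (\<forall>u v. {u, v} \<in> E \<longrightarrow> \<phi> u \<noteq> \<phi> v)"

definition conflicted :: "'v set \<Rightarrow> 'v edges \<Rightarrow> ('v \<Rightarrow> nat) \<Rightarrow> 'v set" where
  "conflicted V E \<phi> = {v \<in> V. \<exists>u \<in> nbrs E v. \<phi> u = \<phi> v}"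

text \<open>
  A probabilistic while loop. Runs are subprobability distributions over final states, as the least
  fixed point; the mass missing from 1 is the probability that the loop runs forever.
\<close>

partial_function (spmf) while_spmf :: "('s \<Rightarrow> bool) \<Rightarrow> ('s \<Rightarrow> 's spmf) \<Rightarrow> 's \<Rightarrow> 's spmf" where
  "while_spmf b f s = (if b s then bind_spmf (f s) (while_spmf b f) else return_spmf s)"

text \<open>
  The state of the algorithm is the current coloring together with the number of recolorings made
  so far.
\<close>

type_synonym 'v state = "('v \<Rightarrow> nat) \<times> nat"

definition recolor :: "'v set \<Rightarrow> 'v edges \<Rightarrow> 'v \<Rightarrow> 'v state \<Rightarrow> 'v state spmf" where
  "recolor V E v = (\<lambda>(\<phi>, k). map_spmf (\<lambda>c. (\<phi>(v := c), k + 1)) (spmf_of_set (palette V E)))"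

definition persist :: "'v set \<Rightarrow> 'v edges \<Rightarrow> 'v \<Rightarrow> 'v state \<Rightarrow> 'v state spmf" where
  "persist V E v = while_spmf (\<lambda>(\<phi>, k). v \<in> conflicted V E \<phi>) (recolor V E v)"

definition pdc_loop :: "'v set \<Rightarrow> 'v edges \<Rightarrow> 'v state \<Rightarrow> 'v state spmf" where
  "pdc_loop V E =
     while_spmf (\<lambda>(\<phi>, k). conflicted V E \<phi> \<noteq> {})
       (\<lambda>(\<phi>, k). bind_spmf (spmf_of_set (conflicted V E \<phi>)) (\<lambda>v. persist V E v (\<phi>, k)))"

text \<open>Colorings are total functions, fixed to the dummy value 0 outside the vertex set.\<close>

definition initial_coloring :: "'v set \<Rightarrow> 'v edges \<Rightarrow> ('v \<Rightarrow> nat) pmf" where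
  "initial_coloring V E = Pi_pmf V 0 (\<lambda>_. pmf_of_set (palette V E))"

definition pdc :: "'v set \<Rightarrow> 'v edges \<Rightarrow> 'v state spmf" where
  "pdc V E = bind_spmf (spmf_of_pmf (initial_coloring V E)) (\<lambda>\<phi>. pdc_loop V E (\<phi>, 0))"

text \<open>
  The expected final value of the counter. For an almost surely terminating run, this is the
  expected total number of recolorings.
\<close>

definition expected_recolorings :: "'v set \<Rightarrow> 'v edges \<Rightarrow> ennreal" where
  "expected_recolorings V E = (\<integral>\<^sup>+ (\<phi>, k). of_nat k \<partial>measure_spmf (pdc V E))"

end

theory Submission
  imports Defs
begin

text \<open>
  A vertex that has been recolored never becomes conflicted again, so the process can be coupled with
  the one that visits all vertices in a uniformly random order and recolors those that are conflicted
  when visited. Put \<open>q = \<Delta> + 1\<close> and let \<open>v\<close> have degree \<open>d\<close>. When \<open>v\<close> is visited, let \<open>T\<close> be the set of its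
  neighbors not yet visited; they still carry their initial colors \<open>\<phi>\<close>. If \<open>v\<close> is conflicted, then
  \<open>\<phi> v \<in> \<phi> ` T\<close>, and at least \<open>q - d + W T\<close> colors are free at \<open>v\<close>, where \<open>W T = card T - card (\<phi> ` T)\<close>.
  Since \<open>W (insert v T) - W T\<close> is the indicator of \<open>\<phi> v \<in> \<phi> ` T\<close>, the expected number of recolorings of
  \<open>v\<close> is at most \<open>q * (H (q - d - 1 + W (insert v T)) - H (q - d - 1 + W T))\<close> with harmonic numbers \<open>H\<close>.
  By exchangeability of the initial colors its mean depends on \<open>card T\<close> only, and \<open>card T\<close> is uniform on
  \<open>{0..d}\<close>. So the sum over \<open>card T\<close> telescopes and bounds the cost of \<open>v\<close> by
  \<open>q * (H (q - 1) - H (q - 1 - d)) / (d + 1) \<le> 2 * H \<Delta>\<close>.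
\<close>

section \<open>Subprobabilistic while loops\<close>

lemma nn_integral_bind_spmf:
  "(\<integral>\<^sup>+y. g y \<partial>measure_spmf (bind_spmf p f)) = (\<integral>\<^sup>+x. \<integral>\<^sup>+y. g y \<partial>measure_spmf (f x) \<partial>measure_spmf p)"
  unfolding measure_spmf_bind
  by (subst nn_integral_bind[where B = "count_space UNIV"]) (auto simp: space_subprob_algebra)

text \<open>The chain may be uncountable, so plain monotone convergence does not apply; but a
  subprobability mass function has countable support, and over a countable set sums commute with
  suprema of chains.\<close>

lemma nn_integral_lub_spmf:
  assumes chain: "Complete_Partial_Order.chain (ord_spmf (=)) Y" and Y: "Y \<noteq> {}"
  shows "(\<integral>\<^sup>+x. g x \<partial>measure_spmf (lub_spmf Y)) = (SUP p\<in>Y. \<integral>\<^sup>+x. g x \<partial>measure_spmf p)"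
proof -
  let ?M = "count_space (set_spmf (lub_spmf Y))"
  have "(\<integral>\<^sup>+x. g x \<partial>measure_spmf (lub_spmf Y)) = (\<integral>\<^sup>+x. ennreal (spmf (lub_spmf Y) x) * g x \<partial>?M)"
    by (rule nn_integral_measure_spmf')
  also have "\<dots> = (\<integral>\<^sup>+x. (SUP p\<in>Y. ennreal (spmf p x) * g x) \<partial>?M)"
    using Y by (simp add: ennreal_spmf_lub_spmf[OF chain] SUP_mult_right_ennreal)
  also have "\<dots> = (SUP p\<in>Y. \<integral>\<^sup>+x. ennreal (spmf p x) * g x \<partial>?M)"
    using Y
  proof (rule nn_integral_monotone_convergence_SUP_countable)
    have "(\<lambda>p x. ennreal (spmf p x) * g x) ` Y = (\<lambda>h x. h x * g x) ` (\<lambda>p x. ennreal (spmf p x)) ` Y"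
      by (simp add: image_image)
    also have "Complete_Partial_Order.chain (\<le>) \<dots>"
      using chain_ord_spmf_eqD[OF chain]
      by (rule chain_imageI) (auto simp: le_fun_def intro: mult_right_mono)
    finally show "Complete_Partial_Order.chain (\<le>) ((\<lambda>p x. ennreal (spmf p x) * g x) ` Y)" .
  qed simp
  also have "\<dots> = (SUP p\<in>Y. \<integral>\<^sup>+x. g x \<partial>measure_spmf p)"
    by (auto simp: nn_integral_measure_spmf nn_integral_count_space_indicator set_lub_spmf[OF chain] spmf_eq_0_set_spmf
        split: split_indicator intro!: arg_cong [of _ _ Sup] image_cong nn_integral_cong)
  finally show ?thesis .
qed

text \<open>\<open>G\<close> acts as a supermartingale certificate. The bound holds for the zero
  subdistribution, survives one unfolding of the loop, and passes to suprema of chains, so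
  fixed-point induction applies.\<close>

lemma nn_integral_while_spmf_le:
  fixes g G :: "'s \<Rightarrow> ennreal"
  assumes exit: "\<And>s. \<not> b s \<Longrightarrow> g s \<le> G s"
    and step: "\<And>s. b s \<Longrightarrow> (\<integral>\<^sup>+s'. G s' \<partial>measure_spmf (f s)) \<le> G s"
  shows "(\<integral>\<^sup>+s'. g s' \<partial>measure_spmf (while_spmf b f s)) \<le> G s"
proof -
  have "\<forall>s. (\<integral>\<^sup>+s'. g s' \<partial>measure_spmf (while_spmf b f s)) \<le> G s"
  proof (induction rule: while_spmf.fixp_induct)
    case 1
    show ?case
    proof (rule ccpo.admissibleI, intro allI)
      fix A :: "((('s \<Rightarrow> bool) \<times> ('s \<Rightarrow> 's spmf)) \<times> 's \<Rightarrow> 's spmf) set" and s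
      assume A: "Complete_Partial_Order.chain spmf.le_fun A" "A \<noteq> {}"
        and le: "\<forall>w\<in>A. \<forall>s. (\<integral>\<^sup>+s'. g s' \<partial>measure_spmf (curry (curry w) b f s)) \<le> G s"
      show "(\<integral>\<^sup>+s'. g s' \<partial>measure_spmf (curry (curry (spmf.lub_fun A)) b f s)) \<le> G s"
        using A le chain_fun[OF A(1), of "((b, f), s)"]
        by (auto simp: fun_lub_def nn_integral_lub_spmf image_def[symmetric] intro!: SUP_least)
    qed
  next
    case 2
    show ?case by simp
  next
    case (3 w)
    show ?case
    proof
      fix s
      show "(\<integral>\<^sup>+s'. g s' \<partial>measure_spmf (if b s then f s \<bind> w b f else return_spmf s)) \<le> G s"
      proof (cases "b s")
        case True
        then have "(\<integral>\<^sup>+s'. g s' \<partial>measure_spmf (if b s then f s \<bind> w b f else return_spmf s)) \<le>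
            (\<integral>\<^sup>+s'. G s' \<partial>measure_spmf (f s))"
          using 3 by (auto simp: nn_integral_bind_spmf intro!: nn_integral_mono)
        with step[OF True] show ?thesis by simp
      next
        case False
        then show ?thesis
          using exit by (simp add: measure_spmf_return_spmf nn_integral_return)
      qed
    qed
  qed
  then show ?thesis by blast
qed

lemma set_while_spmf:
  assumes init: "I s" and step: "\<And>s s'. I s \<Longrightarrow> b s \<Longrightarrow> s' \<in> set_spmf (f s) \<Longrightarrow> I s'"
    and s': "s' \<in> set_spmf (while_spmf b f s)"
  shows "I s' \<and> \<not> b s'"
proof -
  \<comment> \<open>\<open>g\<close> penalizes bad exits, and \<open>G\<close> is infinite off the
    invariant, where the drift condition is then trivial.\<close>
  define g where "g = (\<lambda>s. if I s \<and> \<not> b s then 0 else 1 :: ennreal)"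
  define G where "G = (\<lambda>s. if I s then 0 else top :: ennreal)"
  have "(\<integral>\<^sup>+s'. g s' \<partial>measure_spmf (while_spmf b f s)) \<le> G s"
  proof (rule nn_integral_while_spmf_le)
    fix s assume "b s"
    show "(\<integral>\<^sup>+s'. G s' \<partial>measure_spmf (f s)) \<le> G s"
    proof (cases "I s")
      case True
      then have "(\<integral>\<^sup>+s'. G s' \<partial>measure_spmf (f s)) = 0"
        using step \<open>b s\<close> by (subst nn_integral_0_iff_AE) (auto simp: G_def)
      then show ?thesis by simp
    qed (simp add: G_def)
  qed (auto simp: g_def G_def)
  then have "(\<integral>\<^sup>+s'. g s' \<partial>measure_spmf (while_spmf b f s)) = 0"
    using init by (simp add: G_def)
  then have "AE x in measure_spmf (while_spmf b f s). g x = 0"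
    by (subst (asm) nn_integral_0_iff_AE) auto
  with s' have "g s' = 0" by simp
  then show ?thesis by (simp add: g_def split: if_splits)
qed

text \<open>Let \<open>w\<close> be the infimum of the termination probability over all invariant
  states. One round exits with probability at least \<open>p\<close> and otherwise reaches a state
  of value at least \<open>w\<close>, so \<open>w + (1 - w) * p \<le> w\<close>, which forces
  \<open>w = 1\<close>.\<close>

lemma lossless_while_spmf:
  assumes p: "0 < p" "p \<le> 1" and init: "I s"
    and lossless: "\<And>s. I s \<Longrightarrow> b s \<Longrightarrow> lossless_spmf (f s)"
    and step: "\<And>s s'. I s \<Longrightarrow> b s \<Longrightarrow> s' \<in> set_spmf (f s) \<Longrightarrow> I s'"
    and exit: "\<And>s. I s \<Longrightarrow> b s \<Longrightarrow> p \<le> measure (measure_spmf (f s)) {s'. \<not> b s'}"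
  shows "lossless_spmf (while_spmf b f s)"
proof -
  define wt where "wt = (\<lambda>s. weight_spmf (while_spmf b f s))"
  define w where "w = (INF s\<in>Collect I. wt s)"
  have bdd: "bdd_below (wt ` Collect I)"
    by (auto intro!: bdd_belowI2[where m = 0] simp: wt_def weight_spmf_nonneg)
  have w_le: "w \<le> wt s" if "I s" for s
    unfolding w_def using bdd that by (auto intro: cINF_lower)
  have wt_le: "wt s \<le> 1" for s by (simp add: wt_def weight_spmf_le_1)
  have wt0: "wt s \<ge> 0" for s by (simp add: wt_def weight_spmf_nonneg)
  have w1: "w \<le> 1" using w_le[OF init] wt_le[of s] by simp
  have wt_exit: "wt s = 1" if "\<not> b s" for s
    using that by (simp add: wt_def while_spmf.simps)
  have "w + (1 - w) * p \<le> wt s" if I: "I s" for s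
  proof (cases "b s")
    case True
    let ?E = "{s'. \<not> b s'}"
    have "w + (1 - w) * p \<le> w + (1 - w) * measure (measure_spmf (f s)) ?E"
      using exit[OF I True] w1 by (simp add: mult_left_mono)
    also have "\<dots> = (\<integral>s'. w + (1 - w) * indicator ?E s' \<partial>measure_spmf (f s))"
      using lossless[OF I True]
      by (subst Bochner_Integration.integral_add)
         (auto simp: lossless_spmf_def measure_spmf.emeasure_eq_measure ennreal_less_top)
    also have "\<dots> \<le> (\<integral>s'. wt s' \<partial>measure_spmf (f s))"
    proof (rule integral_mono_AE)
      show "integrable (measure_spmf (f s)) wt"
        by (rule measure_spmf.integrable_const_bound[where B = 1]) (auto simp: wt_le wt0)
      show "AE s' in measure_spmf (f s). w + (1 - w) * indicator ?E s' \<le> wt s'"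
        using step[OF I True] w_le by (auto simp: wt_exit split: split_indicator)
    qed (auto simp: measure_spmf.emeasure_eq_measure ennreal_less_top)
    also have "\<dots> = wt s"
      using True unfolding wt_def while_spmf.simps[of b f s] by (simp add: weight_bind_spmf o_def)
    finally show ?thesis .
  next
    case False
    have "(1 - w) * p \<le> 1 - w" using w1 p by (simp add: mult_left_le)
    with False show ?thesis by (simp add: wt_exit)
  qed
  then have "w + (1 - w) * p \<le> w"
    unfolding w_def using init by (intro cINF_greatest) auto
  then have "w \<ge> 1" using p by (simp add: mult_le_0_iff)
  with w_le[OF init] wt_le[of s] show ?thesis by (simp add: lossless_spmf_def wt_def)
qed

section \<open>Random removal orders\<close>

text \<open>
  The expected total cost of emptying \<open>R\<close> in uniformly random order, when removing \<open>v\<close> from the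
  remaining set \<open>S\<close> costs \<open>c v S\<close>.
\<close>

function order_mean :: "('a \<Rightarrow> 'a set \<Rightarrow> real) \<Rightarrow> 'a set \<Rightarrow> real" where
  "order_mean c R = (if finite R \<and> R \<noteq> {}
     then (\<Sum>v\<in>R. c v R + order_mean c (R - {v})) / real (card R) else 0)"
  by pat_completeness auto
termination
  by (relation "Wellfounded.measure (\<lambda>(c, R). card R)") (simp_all add: card_gt_0_iff)

declare order_mean.simps [simp del]

lemma order_mean_rec:
  assumes "finite R" "R \<noteq> {}"
  shows "real (card R) * order_mean c R = (\<Sum>v\<in>R. c v R + order_mean c (R - {v}))"
  using assms by (subst order_mean.simps) (simp add: card_gt_0_iff)

lemma order_mean_cong:
  assumes "\<And>v S. S \<subseteq> R \<Longrightarrow> v \<in> S \<Longrightarrow> c v S = c' v S"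
  shows "order_mean c R = order_mean c' R"
  using assms
proof (induction c R rule: order_mean.induct)
  case (1 c R)
  have "c v R + order_mean c (R - {v}) = c' v R + order_mean c' (R - {v})" if "finite R" "v \<in> R" for v
  proof -
    have "order_mean c (R - {v}) = order_mean c' (R - {v})"
      using that "1.prems" by (intro "1.IH") auto
    then show ?thesis using that "1.prems" by simp
  qed
  then show ?case
    by (subst (1 2) order_mean.simps) (auto intro!: sum.cong)
qed

lemma order_mean_nonneg:
  assumes "\<And>v S. S \<subseteq> R \<Longrightarrow> v \<in> S \<Longrightarrow> c v S \<ge> 0"
  shows "order_mean c R \<ge> 0"
  using assms
proof (induction c R rule: order_mean.induct)
  case (1 c R)
  have "c v R + order_mean c (R - {v}) \<ge> 0" if "finite R" "v \<in> R" for v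
  proof -
    have "order_mean c (R - {v}) \<ge> 0"
      using that "1.prems" by (intro "1.IH") auto
    then show ?thesis using that "1.prems"[of R v] by simp
  qed
  then show ?case
    by (subst order_mean.simps) (auto intro!: sum_nonneg divide_nonneg_nonneg)
qed

text \<open>Linearity: the removal order is independent of \<open>x\<close>, so the mean over
  \<open>x\<close> can be taken visit by visit.\<close>

lemma expectation_order_mean:
  fixes c :: "'b \<Rightarrow> 'a \<Rightarrow> 'a set \<Rightarrow> real"
  assumes p: "finite (set_pmf p)" and "finite R"
  shows "measure_pmf.expectation p (\<lambda>x. order_mean (c x) R) =
     order_mean (\<lambda>v S. measure_pmf.expectation p (\<lambda>x. c x v S)) R"
  using \<open>finite R\<close>
proof (induction "card R" arbitrary: R rule: less_induct)
  case less
  have IH: "measure_pmf.expectation p (\<lambda>x. order_mean (c x) (R - {v})) =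
     order_mean (\<lambda>v S. measure_pmf.expectation p (\<lambda>x. c x v S)) (R - {v})" if "v \<in> R" for v
    using that less.prems by (intro less.hyps card_Diff1_less) auto
  note [simp] = integrable_measure_pmf_finite[OF p]
  show ?case
    using less.prems IH
    by (cases "R = {}") (simp_all add: order_mean.simps[of _ "{}"] order_mean.simps[of _ R] cong: sum.cong)
qed

text \<open>
  When \<open>R\<close> is emptied in a uniformly random order, the number of elements of \<open>N v \<inter> R\<close> that
  are still present when \<open>v\<close> is removed is uniform on \<open>{0..card (N v \<inter> R)}\<close>.
\<close>

lemma order_mean_card:
  assumes "finite R" and irrefl: "\<And>v. v \<notin> N v" and sym: "\<And>u v. u \<in> N v \<longleftrightarrow> v \<in> N u"
    and c: "\<And>v S. S \<subseteq> R \<Longrightarrow> v \<in> S \<Longrightarrow> c v S = h v (card (N v \<inter> S))"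
  shows "order_mean c R =
     (\<Sum>v\<in>R. (\<Sum>l\<le>card (N v \<inter> R). h v l) / (real (card (N v \<inter> R)) + 1))"
  using assms(1) c
proof (induction "card R" arbitrary: R rule: less_induct)
  case less
  define A where "A = (\<lambda>v r. (\<Sum>l\<le>r. h v l) / (real r + 1))"
  define r where "r = (\<lambda>v. card (N v \<inter> R))"
  show ?case
  proof (cases "R = {}")
    case False
    \<comment> \<open>\<open>A v j\<close> averages \<open>h v\<close> over \<open>{0..j}\<close>.
      Among \<open>v\<close> and its \<open>j\<close> present neighbors each is equally likely to go
      first; at \<open>j = 0\<close> the truncated \<open>j - 1\<close> has factor 0.\<close>
    have A_step: "h v j + real j * A v (j - 1) = (real j + 1) * A v j" for v j
      by (cases j) (auto simp: A_def field_simps add_eq_0_iff)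
    have IH: "order_mean c (R - {v}) = (\<Sum>u\<in>R. if v = u then 0 else A u (r u - (if u \<in> N v then 1 else 0)))"
      if v: "v \<in> R" for v
    proof -
      have "card (N u \<inter> (R - {v})) = r u - (if u \<in> N v then 1 else 0)" for u
      proof -
        have "N u \<inter> (R - {v}) = N u \<inter> R - {v}" by auto
        then show ?thesis using v sym[of u v] less.prems(1) by (simp add: r_def)
      qed
      moreover have "order_mean c (R - {v}) =
          (\<Sum>u\<in>R - {v}. A u (card (N u \<inter> (R - {v}))))"
        unfolding A_def using v less.prems
        by (intro less.hyps card_Diff1_less) auto
      moreover have "(\<Sum>u\<in>R. if v = u then 0 else A u (r u - (if u \<in> N v then 1 else 0))) =
          (\<Sum>u\<in>R - {v}. A u (r u - (if u \<in> N v then 1 else 0)))"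
        using v less.prems(1) by (intro sum.mono_neutral_cong_right) auto
      ultimately show ?thesis by simp
    qed
    \<comment> \<open>For fixed \<open>u\<close>, the first removal is \<open>u\<close> itself, one
      of its \<open>r u\<close> neighbors, or one of the rest, which leave the count
      unchanged.\<close>
    have *: "(\<Sum>v\<in>R. if v = u then 0 else A u (r u - (if u \<in> N v then 1 else 0))) =
        (real (card R) - 1 - real (r u)) * A u (r u) + real (r u) * A u (r u - 1)" if u: "u \<in> R" for u
    proof -
      have fin: "finite R" by fact
      have "(\<Sum>v\<in>R. if v = u then 0 else A u (r u - (if u \<in> N v then 1 else 0))) =
          (\<Sum>v\<in>R. A u (r u) - (if v = u then A u (r u) else 0)
             + (if v \<in> N u then A u (r u - 1) - A u (r u) else 0))"
        using irrefl sym[of u] by (intro sum.cong) auto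
      also have "\<dots> = real (card R) * A u (r u) - A u (r u) + real (card (R \<inter> N u)) * (A u (r u - 1) - A u (r u))"
        using u fin by (simp add: sum.distrib sum_subtractf flip: sum.inter_restrict)
      also have "card (R \<inter> N u) = r u" by (simp add: r_def Int_commute)
      finally show ?thesis by (simp add: algebra_simps)
    qed
    have "real (card R) * order_mean c R = (\<Sum>v\<in>R. h v (r v) + order_mean c (R - {v}))"
      unfolding order_mean_rec[OF less.prems(1) False] using less.prems(2) by (simp add: r_def)
    also have "\<dots> = (\<Sum>v\<in>R. h v (r v)) +
        (\<Sum>v\<in>R. \<Sum>u\<in>R. if v = u then 0 else A u (r u - (if u \<in> N v then 1 else 0)))"
      by (simp only: sum.distrib IH cong: sum.cong)
    also have "(\<Sum>v\<in>R. \<Sum>u\<in>R. if v = u then 0 else A u (r u - (if u \<in> N v then 1 else 0))) =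
        (\<Sum>u\<in>R. (real (card R) - 1 - real (r u)) * A u (r u) + real (r u) * A u (r u - 1))"
      by (subst sum.swap) (simp add: *)
    also have "(\<Sum>v\<in>R. h v (r v)) + \<dots> = (\<Sum>u\<in>R. real (card R) * A u (r u))"
    proof (subst sum.distrib[symmetric], rule sum.cong[OF refl])
      fix u
      show "h u (r u) + ((real (card R) - 1 - real (r u)) * A u (r u) + real (r u) * A u (r u - 1)) =
          real (card R) * A u (r u)"
        using A_step[of u "r u"] by (simp add: algebra_simps)
    qed
    also have "\<dots> = real (card R) * (\<Sum>u\<in>R. A u (r u))" by (simp add: sum_distrib_left)
    finally have "order_mean c R = (\<Sum>u\<in>R. A u (r u))"
      using False less.prems(1) by (simp add: card_gt_0_iff)
    then show ?thesis by (simp add: A_def r_def)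
  qed (simp add: order_mean.simps)
qed

section \<open>Repeated colors in a vertex set\<close>

definition waste :: "('v \<Rightarrow> nat) \<Rightarrow> 'v set \<Rightarrow> nat" where
  "waste \<phi> T = card T - card (\<phi> ` T)"

lemma waste_insert:
  assumes "finite T" "v \<notin> T"
  shows "waste \<phi> (insert v T) = waste \<phi> T + (if \<phi> v \<in> \<phi> ` T then 1 else 0)"
  using assms card_image_le[of T \<phi>] by (auto simp: waste_def insert_absorb)

lemma waste_empty [simp]: "waste \<phi> {} = 0"
  by (simp add: waste_def)

lemma waste_le: 
  assumes "finite T" "T \<noteq> {}"
  shows "waste \<phi> T \<le> card T - 1"
  using assms by (simp add: waste_def card_gt_0_iff Suc_leI diff_le_mono2)

text \<open>The coordinates are independent and identically distributed, so permuting them keeps the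
  law; \<open>h\<close> is a permutation of \<open>V\<close> that carries \<open>S\<close> to
  \<open>T\<close>.\<close>

lemma expectation_waste_eq:
  fixes p :: "nat pmf" and f :: "nat \<Rightarrow> real"
  assumes V: "finite V" and S: "S \<subseteq> V" and T: "T \<subseteq> V" and card: "card S = card T"
  shows "measure_pmf.expectation (Pi_pmf V d (\<lambda>_. p)) (\<lambda>\<phi>. f (waste \<phi> S)) =
     measure_pmf.expectation (Pi_pmf V d (\<lambda>_. p)) (\<lambda>\<phi>. f (waste \<phi> T))"
proof -
  have fin: "finite S" "finite T" using V S T finite_subset by auto
  obtain g where g: "bij_betw g S T"
    using fin card by (metis finite_same_card_bij)
  obtain g' where g': "bij_betw g' (V - S) (V - T)"
    using V S T card fin by (metis card_Diff_subset finite_Diff finite_same_card_bij)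
  define h where "h = (\<lambda>x. if x \<in> S then g x else if x \<in> V then g' x else x)"
  have hST: "bij_betw h S T"
    using g by (subst bij_betw_cong[of _ _ g]) (auto simp: h_def)
  have "bij_betw h (V - S) (V - T)"
    using g' by (subst bij_betw_cong[of _ _ g']) (auto simp: h_def)
  then have "bij_betw h (S \<union> (V - S)) (T \<union> (V - T))"
    by (intro bij_betw_combine[OF hST]) auto
  then have h: "bij_betw h V V" using S T by (simp add: Un_absorb1)
  have "h ` S = T" "inj_on h S" using hST by (auto simp: bij_betw_def)
  then have "waste (\<phi> \<circ> h) S = waste \<phi> T" for \<phi> :: "'a \<Rightarrow> nat"
    using card by (metis waste_def image_comp)
  moreover have "Pi_pmf V d (\<lambda>_. p) = map_pmf (\<lambda>\<phi>. \<phi> \<circ> h) (Pi_pmf V d (\<lambda>_. p))"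
    using V h S by (intro Pi_pmf_bij_betw) (auto simp: h_def)
  from arg_cong[OF this, of "\<lambda>P. measure_pmf.expectation P (\<lambda>\<phi>. f (waste \<phi> S))"]
  have "measure_pmf.expectation (Pi_pmf V d (\<lambda>_. p)) (\<lambda>\<phi>. f (waste \<phi> S)) =
      measure_pmf.expectation (Pi_pmf V d (\<lambda>_. p)) (\<lambda>\<phi>. f (waste (\<phi> \<circ> h) S))"
    by simp
  ultimately show ?thesis by simp
qed

section \<open>Harmonic number estimates\<close>

lemma harm_le_ln: "harm n \<le> (1 + 1 / ln 2) * ln (real (max 2 n))"
proof -
  have "ln (real (max 2 n)) \<ge> ln 2" by simp
  \<comment> \<open>This absorbs the additive 1 of the bound \<open>1 + ln n\<close> and is the
    source of the constant \<open>1 / ln 2\<close>.\<close>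
  then have 1: "1 \<le> 1 / ln 2 * ln (real (max 2 n))" by (simp add: field_simps)
  have "harm n \<le> 1 + ln (real (max 2 n))"
  proof (cases n)
    case (Suc k)
    have "harm n - ln (real n) \<le> harm 1 - ln (real 1)"
      using decseqD[OF decseq_harm_diff_ln, of 0 k] by (simp add: Suc)
    moreover have "ln (real n) \<le> ln (real (max 2 n))" using Suc by simp
    ultimately show ?thesis by (simp add: harm_def)
  qed (simp add: harm_def)
  also have "\<dots> \<le> 1 / ln 2 * ln (real (max 2 n)) + ln (real (max 2 n))" using 1 by simp
  finally show ?thesis by (simp only: distrib_right mult_1 add.commute)
qed

text \<open>If \<open>q \<le> 2 * (d + 1)\<close>, the factor \<open>q / (d + 1)\<close> is at most
  2. Otherwise each of the \<open>d\<close> reciprocals in the difference is at most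
  \<open>2 / q\<close>, which bounds the left side by 2, and \<open>harm (q - 1)\<close> is at least
  1 for positive \<open>d\<close>.\<close>

lemma harm_average_le:
  assumes d: "d < q"
  shows "real q * (harm (q - 1) - harm (q - 1 - d)) / (real d + 1) \<le> 2 * harm (q - 1)"
proof (cases "d = 0")
  case False
  have H1: "harm (q - 1) \<ge> (1::real)"
    using harm_mono[of 1 "q - 1", where 'a = real] d False by (simp add: harm_def)
  show ?thesis
  proof (cases "q \<le> 2 * (d + 1)")
    case True
    have "real q * (harm (q - 1) - harm (q - 1 - d)) \<le> (2 * (real d + 1)) * harm (q - 1)"
      using True by (intro mult_mono) (auto simp: harm_nonneg harm_mono)
    then show ?thesis by (simp add: field_simps)
  next
    case big: False
    have split: "{1..q - 1} = {1..q - 1 - d} \<union> {q - d..q - 1}" using d by auto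
    have "harm (q - 1) - harm (q - 1 - d) = (\<Sum>i = q - d..q - 1. inverse (real i))"
      unfolding harm_def split by (subst sum.union_disjoint) auto
    also have "\<dots> \<le> (\<Sum>i = q - d..q - 1. 2 / real q)"
      using big by (intro sum_mono) (auto simp: field_simps)
    also have "\<dots> = 2 * real d / real q" using d by simp
    finally have "real q * (harm (q - 1) - harm (q - 1 - d)) \<le> 2 * real d"
      using d by (simp add: field_simps)
    also have "\<dots> \<le> (2 * harm (q - 1)) * (real d + 1)"
      using H1 by (intro mult_mono) auto
    finally show ?thesis by (simp add: field_simps)
  qed
qed (use harm_nonneg in auto)

section \<open>The recoloring process\<close>

lemma ennreal_divide_of_nat: "a \<ge> 0 \<Longrightarrow> n > 0 \<Longrightarrow> ennreal a / of_nat n = ennreal (a / real n)"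
  by (simp add: divide_ennreal ennreal_of_nat_eq_real_of_nat)

locale finite_simple_graph =
  fixes V :: "'v set" and E :: "'v edges"
  assumes graph: "simple_graph V E"
begin

abbreviation q :: nat where "q \<equiv> max_degree V E + 1"
abbreviation N :: "'v \<Rightarrow> 'v set" where "N \<equiv> nbrs E"
abbreviation U :: "('v \<Rightarrow> nat) \<Rightarrow> 'v set" where "U \<equiv> conflicted V E"

lemma finite_V: "finite V"
  using graph by (simp add: simple_graph_def)

lemma N_sym: "u \<in> N v \<longleftrightarrow> v \<in> N u"
  by (simp add: nbrs_def insert_commute)

lemma N_irrefl: "v \<notin> N v"
  using graph by (auto simp: simple_graph_def nbrs_def)

lemma N_subset: "N v \<subseteq> V"
  using graph by (auto simp: simple_graph_def nbrs_def)

lemma finite_N: "finite (N v)"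
  using finite_subset[OF N_subset finite_V] .

lemma degree_less_q: "v \<in> V \<Longrightarrow> card (N v) < q"
  using finite_V by (auto simp: max_degree_def less_Suc_eq_le intro!: Max_ge)

lemma finite_palette: "finite (palette V E)" and card_palette: "card (palette V E) = q"
  and palette_nonempty: "palette V E \<noteq> {}"
  by (auto simp: palette_def)

lemma U_subset: "U \<phi> \<subseteq> V"
  by (auto simp: conflicted_def)

lemma finite_U: "finite (U \<phi>)"
  using finite_subset[OF U_subset finite_V] .

lemma conflicted_upd_iff:
  assumes "v \<in> V"
  shows "v \<in> U (\<phi>(v := c)) \<longleftrightarrow> c \<in> \<phi> ` N v"
  using assms N_irrefl[of v] by (auto simp: conflicted_def image_iff)

text \<open>No neighbor of \<open>v\<close> has color \<open>c\<close>, so an edge in conflict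
  afterwards avoids \<open>v\<close> and was in conflict before. Hence the conflicted set only
  shrinks from phase to phase.\<close>

lemma conflicted_upd_subset:
  assumes "v \<in> V" "c \<notin> \<phi> ` N v"
  shows "U (\<phi>(v := c)) \<subseteq> U \<phi> - {v}"
proof
  fix u assume u: "u \<in> U (\<phi>(v := c))"
  then obtain w where w: "w \<in> N u" "(\<phi>(v := c)) w = (\<phi>(v := c)) u"
    by (auto simp: conflicted_def)
  have "u \<noteq> v" using u conflicted_upd_iff assms by auto
  moreover have "w \<noteq> v" using w \<open>u \<noteq> v\<close> assms(2) N_sym[of w u] by auto
  ultimately show "u \<in> U \<phi> - {v}"
    using u w by (auto simp: conflicted_def)
qed

definition free :: "('v \<Rightarrow> nat) \<Rightarrow> 'v \<Rightarrow> nat set" where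
  "free \<phi> v = palette V E - \<phi> ` N v"

lemma card_free_pos: 
  assumes "v \<in> V"
  shows "card (free \<phi> v) > 0"
proof -
  have "q - card (\<phi> ` N v) \<le> card (free \<phi> v)"
    unfolding free_def card_palette[symmetric] using finite_N by (intro diff_card_le_card_Diff) auto
  with degree_less_q[OF assms] card_image_le[OF finite_N, of \<phi> v] show ?thesis by simp
qed

section \<open>One persistence phase\<close>

lemma set_recolor:
  "set_spmf (recolor V E v (\<phi>, k)) = (\<lambda>c. (\<phi>(v := c), k + 1)) ` palette V E"
  by (simp add: recolor_def finite_palette)

lemma nn_integral_recolor:
  "(\<integral>\<^sup>+s. G s \<partial>measure_spmf (recolor V E v (\<phi>, k))) = (\<Sum>c\<in>palette V E. G (\<phi>(v := c), k + 1)) / of_nat q"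
  by (simp add: recolor_def nn_integral_spmf_of_set card_palette)

lemma set_persist:
  assumes v: "v \<in> U \<phi>" and s: "s \<in> set_spmf (persist V E v (\<phi>, k))"
  shows "\<exists>c\<in>free \<phi> v. fst s = \<phi>(v := c)"
proof -
  \<comment> \<open>The first disjunct covers the original color of \<open>v\<close>; at exit it
    fails, which leaves \<open>c\<close> in the palette.\<close>
  define I where "I = (\<lambda>(\<psi>, j::nat). \<exists>c. \<psi> = \<phi>(v := c) \<and> (v \<in> U \<psi> \<or> c \<in> palette V E))"
  have "I s \<and> \<not> (\<lambda>(\<psi>, j). v \<in> U \<psi>) s"
  proof (rule set_while_spmf[where b = "\<lambda>(\<psi>, j). v \<in> U \<psi>" and f = "recolor V E v"])
    show "I (\<phi>, k)" using v by (auto simp: I_def intro!: exI[of _ "\<phi> v"])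
    show "s \<in> set_spmf (while_spmf (\<lambda>(\<psi>, j). v \<in> U \<psi>) (recolor V E v) (\<phi>, k))"
      using s by (simp add: persist_def)
    show "I t'" if "I t" "t' \<in> set_spmf (recolor V E v t)" for t t'
      using that by (cases t) (auto simp: I_def set_recolor)
  qed
  then obtain c where c: "fst s = \<phi>(v := c)" "v \<notin> U (\<phi>(v := c))" "c \<in> palette V E"
    by (cases s) (auto simp: I_def)
  moreover have "v \<in> V" using v U_subset by auto
  ultimately show ?thesis
    by (intro bexI[of _ c]) (simp_all add: free_def conflicted_upd_iff)
qed

text \<open>Whatever color \<open>v\<close> currently has, the same free colors, at least one, end
  the phase, so each attempt succeeds with probability at least \<open>1 / q\<close>.\<close>

lemma lossless_persist:
  assumes v: "v \<in> V"
  shows "lossless_spmf (persist V E v (\<phi>, k))"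
  unfolding persist_def
proof (rule lossless_while_spmf[where p = "1 / real q" and I = "\<lambda>(\<psi>, j). \<exists>c. \<psi> = \<phi>(v := c)"])
  show "case (\<phi>, k) of (\<psi>, j) \<Rightarrow> \<exists>c. \<psi> = \<phi>(v := c)"
    by (auto intro!: exI[of _ "\<phi> v"])
next
  fix s :: "'v state" assume "case s of (\<psi>, j) \<Rightarrow> \<exists>c. \<psi> = \<phi>(v := c)"
  then obtain c j where s: "s = (\<phi>(v := c), j)" by (cases s) auto
  show "lossless_spmf (recolor V E v s)"
    by (simp add: s recolor_def finite_palette palette_nonempty)
  obtain d where d: "d \<in> free \<phi> v" using card_free_pos[OF v, of \<phi>] by (auto simp: card_gt_0_iff)
  have "measure (measure_spmf (recolor V E v s)) {s'. \<not> (case s' of (\<psi>, j) \<Rightarrow> v \<in> U \<psi>)} =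
      real (card (palette V E \<inter> {c. c \<notin> \<phi> ` N v})) / real q"
    using v by (simp add: s recolor_def measure_map_spmf vimage_def measure_spmf_of_set card_palette conflicted_upd_iff)
  moreover have "card (palette V E \<inter> {c. c \<notin> \<phi> ` N v}) \<ge> 1"
    using d finite_palette by (auto simp: free_def Suc_le_eq card_gt_0_iff)
  ultimately show "1 / real q \<le> measure (measure_spmf (recolor V E v s)) {s'. \<not> (case s' of (\<psi>, j) \<Rightarrow> v \<in> U \<psi>)}"
    by (simp add: divide_right_mono)
qed (auto simp: set_recolor)

text \<open>The number of attempts is geometric with success probability
  \<open>card (free \<phi> v) / q\<close>, hence has mean \<open>q / card (free \<phi> v)\<close>;
  \<open>M\<close> bounds what is charged after the phase.\<close>

lemma nn_integral_persist_le:
  assumes v: "v \<in> U \<phi>" and M: "M \<ge> 0"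
    and X: "\<And>c. c \<in> free \<phi> v \<Longrightarrow> X (\<phi>(v := c)) \<le> ennreal M"
  shows "(\<integral>\<^sup>+(\<psi>, j). of_nat j + X \<psi> \<partial>measure_spmf (persist V E v (\<phi>, k))) \<le>
    ennreal (real k + real q / real (card (free \<phi> v)) + M)"
proof -
  let ?a = "card (free \<phi> v)"
  have vV: "v \<in> V" using v U_subset by auto
  define I where "I = (\<lambda>\<psi>. \<exists>c. \<psi> = \<phi>(v := c) \<and> (v \<in> U \<psi> \<or> c \<in> palette V E))"
  \<comment> \<open>The expected waiting time is charged only while \<open>v\<close> is conflicted;
    the value \<open>top\<close> off the invariant makes the drift condition trivial there.\<close>
  define G where "G = (\<lambda>(\<psi>, j). if I \<psi>
     then ennreal (real j + M + (if v \<in> U \<psi> then real q / real ?a else 0)) else top)"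
  have "(\<integral>\<^sup>+s. (case s of (\<psi>, j) \<Rightarrow> of_nat j + X \<psi>) \<partial>measure_spmf (persist V E v (\<phi>, k))) \<le> G (\<phi>, k)"
    unfolding persist_def
  proof (rule nn_integral_while_spmf_le)
    fix s :: "'v state" assume s: "\<not> (case s of (\<psi>, j) \<Rightarrow> v \<in> U \<psi>)"
    obtain \<psi> j where [simp]: "s = (\<psi>, j)" by (cases s)
    show "(case s of (\<psi>, j) \<Rightarrow> of_nat j + X \<psi>) \<le> G s"
    proof (cases "I \<psi>")
      case True
      then have "X \<psi> \<le> ennreal M"
        using s X conflicted_upd_iff[OF vV] by (auto simp: I_def free_def)
      then show ?thesis
        using True s M by (simp add: G_def ennreal_plus ennreal_of_nat_eq_real_of_nat add_left_mono)
    qed (simp add: G_def)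
  next
    fix s :: "'v state" assume s: "case s of (\<psi>, j) \<Rightarrow> v \<in> U \<psi>"
    obtain \<psi> j where [simp]: "s = (\<psi>, j)" by (cases s)
    show "(\<integral>\<^sup>+s'. G s' \<partial>measure_spmf (recolor V E v s)) \<le> G s"
    proof (cases "I \<psi>")
      case True
      then obtain c0 where \<psi>: "\<psi> = \<phi>(v := c0)" by (auto simp: I_def)
      define w where "w = (\<lambda>c. real (j + 1) + M + (if c \<in> \<phi> ` N v then real q / real ?a else 0))"
      have w0: "w c \<ge> 0" for c using M by (simp add: w_def)
      have "G (\<psi>(v := c), j + 1) = ennreal (w c)" if "c \<in> palette V E" for c
        using that by (auto simp: G_def w_def I_def \<psi> conflicted_upd_iff[OF vV])
      then have "(\<integral>\<^sup>+s'. G s' \<partial>measure_spmf (recolor V E v s)) = (\<Sum>c\<in>palette V E. ennreal (w c)) / of_nat q"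
        by (simp only: \<open>s = (\<psi>, j)\<close> nn_integral_recolor cong: sum.cong)
      also have "\<dots> = ennreal ((\<Sum>c\<in>palette V E. w c) / real q)"
        using w0 by (subst sum_ennreal) (simp_all only: sum_nonneg ennreal_divide_of_nat zero_less_one add_nonneg_pos zero_le)
      \<comment> \<open>One attempt costs 1 and fails with probability \<open>(q - ?a) / q\<close>,
        and \<open>1 + ((q - ?a) / q) * (q / ?a) = q / ?a\<close>, so the drift is exactly
        zero.\<close>
      also have "(\<Sum>c\<in>palette V E. w c) / real q = real j + M + real q / real ?a"
      proof -
        have split: "card (palette V E \<inter> \<phi> ` N v) + ?a = q"
          unfolding free_def card_palette[symmetric]
          using finite_palette by (metis card_Int_Diff)
        have "(\<Sum>c\<in>palette V E. w c) = real q * (real (j + 1) + M) + real (card (palette V E \<inter> \<phi> ` N v)) * (real q / real ?a)"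
          using finite_palette by (simp add: w_def sum.distrib card_palette flip: sum.inter_restrict)
        also have "real (card (palette V E \<inter> \<phi> ` N v)) = real q - real ?a"
          using split by linarith
        finally show ?thesis
          using card_free_pos[OF vV, of \<phi>] by (simp add: field_simps)
      qed
      finally show ?thesis using s True by (simp add: G_def)
    qed (simp add: G_def)
  qed
  moreover have "I \<phi>" using v by (auto simp: I_def intro!: exI[of _ "\<phi> v"])
  ultimately show ?thesis using v by (simp add: G_def algebra_simps)
qed

section \<open>Termination and correctness\<close>

lemma lossless_pdc_loop: "lossless_spmf (pdc_loop V E (\<phi>, k))"
proof (induction "card (U \<phi>)" arbitrary: \<phi> k rule: less_induct)
  case less
  show ?case
  proof (cases "U \<phi> = {}")
    case True
    then show ?thesis by (simp add: pdc_loop_def while_spmf.simps)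
  next
    case False
    \<comment> \<open>Every phase frees the chosen vertex and makes no other vertex newly
      conflicted, so the conflicted set strictly shrinks.\<close>
    have "lossless_spmf (pdc_loop V E s)" if v: "v \<in> U \<phi>" and s: "s \<in> set_spmf (persist V E v (\<phi>, k))" for v s
    proof -
      obtain c where c: "c \<in> free \<phi> v" "fst s = \<phi>(v := c)" using set_persist[OF v s] by auto
      have "U (fst s) \<subseteq> U \<phi> - {v}"
        using conflicted_upd_subset[of v c \<phi>] v c U_subset by (auto simp: free_def)
      then have "card (U (fst s)) < card (U \<phi>)"
        using v finite_U by (intro psubset_card_mono) auto
      from less[OF this, of "snd s"] show ?thesis by simp
    qed
    then show ?thesis
      using False finite_U U_subset unfolding pdc_loop_def
      by (subst while_spmf.simps) (auto simp: lossless_persist subset_iff)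
  qed
qed

lemma set_pdc_loop:
  assumes s: "s \<in> set_spmf (pdc_loop V E (\<phi>, k))" and \<phi>: "\<And>v. v \<in> V \<Longrightarrow> \<phi> v \<in> palette V E"
  shows "proper_coloring V E (palette V E) (fst s)"
proof -
  define I where "I = (\<lambda>s :: 'v state. \<forall>v\<in>V. fst s v \<in> palette V E)"
  have "I s \<and> \<not> (case s of (\<psi>, j) \<Rightarrow> U \<psi> \<noteq> {})"
  proof (rule set_while_spmf[OF _ _ s[unfolded pdc_loop_def]])
    show "I (\<phi>, k)" using \<phi> by (simp add: I_def)
    show "I t'" if t: "I t" "case t of (\<psi>, j) \<Rightarrow> U \<psi> \<noteq> {}"
      "t' \<in> set_spmf (case t of (\<phi>, k) \<Rightarrow> spmf_of_set (U \<phi>) \<bind> (\<lambda>v. persist V E v (\<phi>, k)))" for t t'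
    proof -
      obtain \<psi> j where [simp]: "t = (\<psi>, j)" by (cases t)
      obtain v where v: "v \<in> U \<psi>" "t' \<in> set_spmf (persist V E v (\<psi>, j))"
        using t finite_U by (auto simp: set_bind_spmf)
      with t(1) set_persist[OF v] show ?thesis by (auto simp: I_def free_def)
    qed
  qed
  then have I: "I s" and U: "U (fst s) = {}" by (cases s; simp)+
  have "fst s u \<noteq> fst s v" if "{u, v} \<in> E" for u v
  proof -
    have uv: "u \<in> N v" using that by (simp add: nbrs_def)
    then have "v \<in> V" using N_sym[of u v] N_subset by auto
    with uv U show ?thesis by (auto simp: conflicted_def)
  qed
  with I show ?thesis by (simp add: I_def proper_coloring_def)
qed

section \<open>Cost of a visit\<close>

text \<open>
  With \<open>T = N v \<inter> R\<close> this is \<open>q / (q - card (N v) + waste \<phi> T)\<close> if \<open>\<phi> v \<in> \<phi> ` T\<close> and \<open>0\<close> otherwise.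
\<close>

definition cost :: "('v \<Rightarrow> nat) \<Rightarrow> 'v \<Rightarrow> 'v set \<Rightarrow> real" where
  "cost \<phi> v R = real q * (harm (q - 1 - card (N v) + waste \<phi> (insert v (N v \<inter> R)))
     - harm (q - 1 - card (N v) + waste \<phi> (N v \<inter> R)))"

lemma cost_nonneg: "cost \<phi> v R \<ge> 0"
proof -
  have "waste \<phi> (N v \<inter> R) \<le> waste \<phi> (insert v (N v \<inter> R))"
    using finite_N N_irrefl by (simp add: waste_insert)
  then show ?thesis by (simp add: cost_def harm_mono)
qed

text \<open>The cost reads colors only inside \<open>R\<close>, so recoloring a vertex already
  removed leaves all later costs unchanged.\<close>

lemma cost_cong:
  assumes "\<And>u. u \<in> R \<Longrightarrow> \<phi> u = \<psi> u" "v \<in> R"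
  shows "cost \<phi> v R = cost \<psi> v R"
proof -
  have "\<phi> ` (N v \<inter> R) = \<psi> ` (N v \<inter> R)" "\<phi> v = \<psi> v"
    using assms by auto
  then show ?thesis by (simp add: cost_def waste_def)
qed

text \<open>A neighbor with the color of \<open>v\<close> is conflicted as well, so it lies in
  \<open>R\<close> and the cost takes its positive value. Each neighbor outside \<open>T\<close>
  adds at most one color to those of \<open>T\<close>, so at most
  \<open>card (N v) - waste \<phi> T\<close> colors are blocked.\<close>

lemma recolorings_le_cost:
  assumes v: "v \<in> U \<phi>" and R: "U \<phi> \<subseteq> R"
  shows "real q / real (card (free \<phi> v)) \<le> cost \<phi> v R"
proof -
  define T where "T = N v \<inter> R"
  have vV: "v \<in> V" using v U_subset by auto
  have T: "finite T" "v \<notin> T" "T \<subseteq> N v" using finite_N N_irrefl by (auto simp: T_def)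
  obtain u where u: "u \<in> N v" "\<phi> u = \<phi> v" using v by (auto simp: conflicted_def)
  then have "u \<in> U \<phi>" using N_subset N_sym[of u v] by (auto simp: conflicted_def)
  then have "u \<in> T" using u R by (auto simp: T_def)
  then have "\<phi> v \<in> \<phi> ` T" using u imageI[of u T \<phi>] by simp
  then have cost: "cost \<phi> v R = real q / real (q - 1 - card (N v) + waste \<phi> T + 1)"
    using T by (simp add: cost_def waste_insert harm_Suc flip: T_def) (simp add: field_simps)
  have "q - card (\<phi> ` N v) \<le> card (free \<phi> v)"
    unfolding free_def card_palette[symmetric] using finite_N by (intro diff_card_le_card_Diff) auto
  moreover have "card (\<phi> ` N v) \<le> card (\<phi> ` T) + (card (N v) - card T)"
  proof -
    have "\<phi> ` N v = \<phi> ` T \<union> \<phi> ` (N v - T)" using T by auto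
    then have "card (\<phi> ` N v) \<le> card (\<phi> ` T) + card (\<phi> ` (N v - T))"
      by (metis card_Un_le)
    also have "card (\<phi> ` (N v - T)) \<le> card (N v) - card T"
      using card_image_le[of "N v - T" \<phi>] finite_N T by (simp add: card_Diff_subset)
    finally show ?thesis by simp
  qed
  moreover have "card (\<phi> ` T) \<le> card T" "card T \<le> card (N v)"
    using T finite_N by (auto intro: card_image_le card_mono)
  ultimately have "q - 1 - card (N v) + waste \<phi> T + 1 \<le> card (free \<phi> v)"
    using degree_less_q[OF vV] by (simp add: waste_def)
  then show ?thesis
    unfolding cost by (intro divide_left_mono) auto
qed

section \<open>The potential and its drift\<close>

text \<open>
  A potential for the loop. Since a recolored vertex never becomes conflicted again, the process
  may be run by visiting the vertices of any set \<open>R \<supseteq> U \<phi>\<close> in random order, skipping those that are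
  not conflicted. The minimum over \<open>R\<close> makes the bound a function of the coloring alone.
\<close>

definition potential :: "('v \<Rightarrow> nat) \<Rightarrow> real" where
  "potential \<phi> = Min (order_mean (cost \<phi>) ` {R. U \<phi> \<subseteq> R \<and> R \<subseteq> V})"

lemma finite_supersets: "finite {R. U \<phi> \<subseteq> R \<and> R \<subseteq> V}"
  by (rule finite_subset[of _ "Pow V"]) (use finite_V in auto)

lemma potential_le: "U \<phi> \<subseteq> R \<Longrightarrow> R \<subseteq> V \<Longrightarrow> potential \<phi> \<le> order_mean (cost \<phi>) R"
  unfolding potential_def using finite_supersets by (intro Min_le) auto

lemma potential_attained:
  obtains R where "U \<phi> \<subseteq> R" "R \<subseteq> V" "potential \<phi> = order_mean (cost \<phi>) R"
proof -
  have "potential \<phi> \<in> order_mean (cost \<phi>) ` {R. U \<phi> \<subseteq> R \<and> R \<subseteq> V}"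
    unfolding potential_def using finite_supersets U_subset by (intro Min_in) auto
  then show ?thesis using that by auto
qed

lemma order_mean_cost_nonneg: "order_mean (cost \<phi>) R \<ge> 0"
  by (intro order_mean_nonneg cost_nonneg)

text \<open>The uniform choice from \<open>U \<phi>\<close> is compared with a uniform choice from a
  minimizing set \<open>R\<close>, in which unconflicted vertices are skipped.\<close>

lemma potential_drift:
  assumes U: "U \<phi> \<noteq> {}"
  shows "(\<integral>\<^sup>+(\<psi>, j). of_nat j + ennreal (potential \<psi>)
       \<partial>measure_spmf (spmf_of_set (U \<phi>) \<bind> (\<lambda>v. persist V E v (\<phi>, k))))
     \<le> of_nat k + ennreal (potential \<phi>)"
proof -
  obtain R where R: "U \<phi> \<subseteq> R" "R \<subseteq> V" "potential \<phi> = order_mean (cost \<phi>) R"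
    by (rule potential_attained)
  have finR: "finite R" using R(2) finite_V finite_subset by auto
  define B where "B = (\<lambda>v. cost \<phi> v R + order_mean (cost \<phi>) (R - {v}))"
  have B0: "B v \<ge> 0" for v by (simp add: B_def cost_nonneg order_mean_cost_nonneg)
  \<comment> \<open>For \<open>v\<close> in \<open>R - U \<phi>\<close>, the set
    \<open>R - {v}\<close> competes in the minimum, so \<open>B v\<close> is at least the potential.
    The average of \<open>B\<close> over \<open>R\<close> equals the potential, so its average over
    \<open>U \<phi>\<close> is at most that.\<close>
  have "(\<Sum>v\<in>U \<phi>. B v) + (\<Sum>v\<in>R - U \<phi>. potential \<phi>) \<le> (\<Sum>v\<in>U \<phi>. B v) + (\<Sum>v\<in>R - U \<phi>. B v)"
  proof (intro add_left_mono sum_mono)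
    fix v assume "v \<in> R - U \<phi>"
    then have "potential \<phi> \<le> order_mean (cost \<phi>) (R - {v})"
      using R by (intro potential_le) auto
    then show "potential \<phi> \<le> B v" using cost_nonneg[of \<phi> v R] by (simp add: B_def)
  qed
  also have "\<dots> = (\<Sum>v\<in>R. B v)"
    using finR R(1) by (metis add.commute sum.subset_diff)
  also have "\<dots> = real (card R) * potential \<phi>"
    unfolding B_def R(3) using finR R(1) U by (intro order_mean_rec[symmetric]) auto
  finally have "(\<Sum>v\<in>U \<phi>. B v) + (real (card R) - real (card (U \<phi>))) * potential \<phi> \<le> real (card R) * potential \<phi>"
    using R(1) finR by (simp add: card_Diff_subset finite_U card_mono of_nat_diff)
  then have sum_B: "(\<Sum>v\<in>U \<phi>. B v) \<le> real (card (U \<phi>)) * potential \<phi>"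
    by (simp add: algebra_simps)
  have step: "(\<integral>\<^sup>+(\<psi>, j). of_nat j + ennreal (potential \<psi>) \<partial>measure_spmf (persist V E v (\<phi>, k)))
      \<le> ennreal (real k + B v)" if v: "v \<in> U \<phi>" for v
  proof -
    \<comment> \<open>After \<open>v\<close> is recolored, \<open>R - {v}\<close> still contains all
      conflicted vertices, and its costs do not see the new color.\<close>
    have "potential (\<phi>(v := c)) \<le> order_mean (cost \<phi>) (R - {v})" if c: "c \<in> free \<phi> v" for c
    proof -
      have "U (\<phi>(v := c)) \<subseteq> R - {v}"
        using conflicted_upd_subset[of v c \<phi>] v c U_subset R(1) by (auto simp: free_def)
      then have "potential (\<phi>(v := c)) \<le> order_mean (cost (\<phi>(v := c))) (R - {v})"
        using R(2) by (intro potential_le) auto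
      also have "\<dots> = order_mean (cost \<phi>) (R - {v})"
        by (intro order_mean_cong cost_cong) auto
      finally show ?thesis .
    qed
    then have "(\<integral>\<^sup>+(\<psi>, j). of_nat j + ennreal (potential \<psi>) \<partial>measure_spmf (persist V E v (\<phi>, k)))
        \<le> ennreal (real k + real q / real (card (free \<phi> v)) + order_mean (cost \<phi>) (R - {v}))"
      by (intro nn_integral_persist_le[OF v order_mean_cost_nonneg] ennreal_leI)
    also have "\<dots> \<le> ennreal (real k + B v)"
      using recolorings_le_cost[OF v R(1)] by (intro ennreal_leI) (simp add: B_def)
    finally show ?thesis .
  qed
  have "(\<integral>\<^sup>+(\<psi>, j). of_nat j + ennreal (potential \<psi>)
       \<partial>measure_spmf (spmf_of_set (U \<phi>) \<bind> (\<lambda>v. persist V E v (\<phi>, k))))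
     \<le> (\<Sum>v\<in>U \<phi>. ennreal (real k + B v)) / of_nat (card (U \<phi>))"
    by (simp add: nn_integral_bind_spmf nn_integral_spmf_of_set step sum_mono divide_right_mono_ennreal)
  also have "\<dots> = ennreal ((\<Sum>v\<in>U \<phi>. real k + B v) / real (card (U \<phi>)))"
    using U finite_U B0
    by (subst sum_ennreal) (simp_all add: sum_nonneg ennreal_divide_of_nat card_gt_0_iff)
  also have "\<dots> \<le> ennreal (real k + potential \<phi>)"
    using sum_B U finite_U by (intro ennreal_leI) (simp add: sum.distrib field_simps card_gt_0_iff)
  also have "\<dots> = of_nat k + ennreal (potential \<phi>)"
    using order_mean_cost_nonneg by (simp add: R(3) ennreal_plus ennreal_of_nat_eq_real_of_nat)
  finally show ?thesis .
qed

lemma nn_integral_pdc_loop_le: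
  "(\<integral>\<^sup>+(\<psi>, j). of_nat j \<partial>measure_spmf (pdc_loop V E (\<phi>, 0))) \<le> ennreal (order_mean (cost \<phi>) V)"
proof -
  have "(\<integral>\<^sup>+s. (case s of (\<psi>, j) \<Rightarrow> of_nat j) \<partial>measure_spmf (pdc_loop V E (\<phi>, 0)))
      \<le> (case (\<phi>, 0) of (\<psi>, j) \<Rightarrow> of_nat j + ennreal (potential \<psi>))"
    unfolding pdc_loop_def
    by (rule nn_integral_while_spmf_le) (auto intro: potential_drift)
  \<comment> \<open>The set \<open>V\<close> is itself admissible in the minimum.\<close>
  also have "\<dots> \<le> ennreal (order_mean (cost \<phi>) V)"
    by (simp add: potential_le U_subset ennreal_leI)
  finally show ?thesis .
qed

section \<open>Averaging over the initial coloring\<close>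

lemma finite_set_initial_coloring: "finite (set_pmf (initial_coloring V E))"
  unfolding initial_coloring_def using finite_V finite_palette palette_nonempty
  by (simp add: set_Pi_pmf finite_PiE_dflt)

lemma expectation_order_mean_cost:
  "measure_pmf.expectation (initial_coloring V E) (\<lambda>\<phi>. order_mean (cost \<phi>) V) \<le>
     2 * real (card V) * harm (q - 1)"
proof -
  let ?p = "initial_coloring V E"
  note [simp] = integrable_measure_pmf_finite[OF finite_set_initial_coloring]
  \<comment> \<open>One representative set for each size: by exchangeability the expectation depends
    on \<open>card T\<close> only, so it can be written \<open>K v (card T)\<close>.\<close>
  define W where "W = (\<lambda>j. SOME T. T \<subseteq> V \<and> card T = j)"
  have W: "W j \<subseteq> V \<and> card (W j) = j" if j: "j \<le> card V" for j
  proof -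
    obtain T where "T \<subseteq> V \<and> card T = j" using obtain_subset_with_card_n[OF j] by auto
    then show ?thesis unfolding W_def by (rule someI)
  qed
  define m where "m = (\<lambda>v. q - 1 - card (N v))"
  have cost_eq: "cost \<phi> v S = real q * (harm (m v + waste \<phi> (insert v (N v \<inter> S))) - harm (m v + waste \<phi> (N v \<inter> S)))"
    for \<phi> v S by (simp add: cost_def m_def)
  define K :: "'v \<Rightarrow> nat \<Rightarrow> real" where
    "K = (\<lambda>v j. measure_pmf.expectation ?p (\<lambda>\<phi>. harm (m v + waste \<phi> (W j))))"
  have K: "measure_pmf.expectation ?p (\<lambda>\<phi>. harm (m v + waste \<phi> T)) = K v (card T)" if "T \<subseteq> V" for T v
  proof -
    have "W (card T) \<subseteq> V \<and> card (W (card T)) = card T"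
      by (rule W[OF card_mono[OF finite_V that]])
    then show ?thesis
      unfolding K_def initial_coloring_def
      using expectation_waste_eq[OF finite_V that, where f = "\<lambda>w. harm (m v + w)"] by metis
  qed
  \<comment> \<open>The expected cost with \<open>l\<close> remaining neighbors is an increment of
    \<open>K v\<close>, so summing over \<open>l\<close> telescopes.\<close>
  define h where "h = (\<lambda>v l. real q * (K v (Suc l) - K v l))"
  have "measure_pmf.expectation ?p (\<lambda>\<phi>. order_mean (cost \<phi>) V) =
      order_mean (\<lambda>v S. measure_pmf.expectation ?p (\<lambda>\<phi>. cost \<phi> v S)) V"
    by (rule expectation_order_mean[OF finite_set_initial_coloring finite_V])
  also have "\<dots> = (\<Sum>v\<in>V. (\<Sum>l\<le>card (N v \<inter> V). h v l) / (real (card (N v \<inter> V)) + 1))"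
  proof (rule order_mean_card[OF finite_V N_irrefl N_sym])
    fix v S assume S: "S \<subseteq> V" "v \<in> S"
    have "insert v (N v \<inter> S) \<subseteq> V" "N v \<inter> S \<subseteq> V" using S by auto
    moreover have "card (insert v (N v \<inter> S)) = Suc (card (N v \<inter> S))"
      using finite_N N_irrefl by simp
    ultimately show "measure_pmf.expectation ?p (\<lambda>\<phi>. cost \<phi> v S) = h v (card (N v \<inter> S))"
      by (simp add: cost_eq h_def K)
  qed
  also have "\<dots> = (\<Sum>v\<in>V. real q * (K v (Suc (card (N v))) - K v 0) / (real (card (N v)) + 1))"
  proof -
    have "(\<Sum>l\<le>n. h v l) = real q * (K v (Suc n) - K v 0)" for n v
      unfolding h_def sum_distrib_left[symmetric] by (simp add: sum_lessThan_telescope flip: lessThan_Suc_atMost)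
    then show ?thesis by (simp only: Int_absorb2[OF N_subset])
  qed
  also have "\<dots> \<le> (\<Sum>v\<in>V. 2 * harm (q - 1))"
  proof (rule sum_mono)
    fix v assume v: "v \<in> V"
    let ?d = "card (N v)"
    have T: "insert v (N v) \<subseteq> V" "card (insert v (N v)) = Suc ?d"
      using v N_subset finite_N N_irrefl by auto
    have "K v (Suc ?d) = measure_pmf.expectation ?p (\<lambda>\<phi>. harm (m v + waste \<phi> (insert v (N v))))"
      using K[OF T(1)] T(2) by simp
    also have "\<dots> \<le> measure_pmf.expectation ?p (\<lambda>_. harm (q - 1))"
    proof (rule integral_mono)
      fix \<phi>
      \<comment> \<open>In any enumeration of a nonempty set the first vertex repeats no color; this
        saved 1 keeps the index at most \<open>q - 1\<close>.\<close>
      have "waste \<phi> (insert v (N v)) \<le> ?d"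
        using waste_le[of "insert v (N v)" \<phi>] T(2) finite_N by simp
      then show "harm (m v + waste \<phi> (insert v (N v))) \<le> (harm (q - 1) :: real)"
        using degree_less_q[OF v] by (intro harm_mono) (simp add: m_def)
    qed auto
    finally have "K v (Suc ?d) \<le> harm (q - 1)" by simp
    moreover have "K v 0 = harm (q - 1 - ?d)"
      using K[of "{}" v] by (simp add: m_def)
    ultimately have "real q * (K v (Suc ?d) - K v 0) / (real ?d + 1) \<le>
        real q * (harm (q - 1) - harm (q - 1 - ?d)) / (real ?d + 1)"
      by (intro divide_right_mono mult_left_mono) auto
    also have "\<dots> \<le> 2 * harm (q - 1)"
      by (rule harm_average_le[OF degree_less_q[OF v]])
    finally show "real q * (K v (Suc ?d) - K v 0) / (real ?d + 1) \<le> 2 * harm (q - 1)" .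
  qed
  finally show ?thesis by simp
qed

lemma expected_recolorings_le:
  "expected_recolorings V E \<le> ennreal (2 * real (card V) * harm (max_degree V E))"
proof -
  let ?p = "initial_coloring V E"
  have "expected_recolorings V E \<le> (\<integral>\<^sup>+\<phi>. ennreal (order_mean (cost \<phi>) V) \<partial>measure_pmf ?p)"
    unfolding expected_recolorings_def pdc_def nn_integral_bind_spmf measure_spmf_spmf_of_pmf
    by (intro nn_integral_mono nn_integral_pdc_loop_le)
  also have "\<dots> = ennreal (measure_pmf.expectation ?p (\<lambda>\<phi>. order_mean (cost \<phi>) V))"
    using integrable_measure_pmf_finite[OF finite_set_initial_coloring] order_mean_cost_nonneg
    by (intro nn_integral_eq_integral) auto
  also have "\<dots> \<le> ennreal (2 * real (card V) * harm (max_degree V E))"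
    using expectation_order_mean_cost by (intro ennreal_leI) simp
  finally show ?thesis .
qed

lemma initial_coloring_in_palette:
  assumes "\<phi> \<in> set_pmf (initial_coloring V E)" "v \<in> V"
  shows "\<phi> v \<in> palette V E"
  using assms finite_V finite_palette palette_nonempty
  by (auto simp: initial_coloring_def set_Pi_pmf PiE_dflt_def)

end

(* The constant C is uniform over all graphs with vertices of the type 'v; with 'v = nat these are
   all finite graphs up to isomorphism. The maximum with 2 gives log Delta its usual reading where
   it vanishes or is undefined: for Delta = 1 the expectation is positive although ln 1 = 0. *)
theorem theorem1:
  shows "\<exists>C > 0 :: real. \<forall>(V :: 'v set) E. simple_graph V E \<longrightarrow>
     lossless_spmf (pdc V E) \<and>
     (\<forall>(\<phi>, k) \<in> set_spmf (pdc V E). proper_coloring V E {1..max_degree V E + 1} \<phi>) \<and>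
     expected_recolorings V E
       \<le> ennreal (C * real (card V) * ln (real (max 2 (max_degree V E))))"
proof (intro exI[of _ "2 * (1 + 1 / ln 2)"] conjI allI impI)
  \<comment> \<open>The factor 2 comes from \<open>harm_average_le\<close>, the factor
    \<open>1 + 1 / ln 2\<close> from \<open>harm_le_ln\<close>.\<close>
  show "2 * (1 + 1 / ln 2) > (0 :: real)" by (simp add: add_pos_nonneg)
next
  fix V :: "'v set" and E assume "simple_graph V E"
  then interpret finite_simple_graph V E by unfold_locales
  show "lossless_spmf (pdc V E)" by (auto simp: pdc_def lossless_pdc_loop)
  show "\<forall>(\<phi>, k) \<in> set_spmf (pdc V E). proper_coloring V E {1..max_degree V E + 1} \<phi>"
  proof
    fix s assume "s \<in> set_spmf (pdc V E)"
    then obtain \<phi> where "\<phi> \<in> set_pmf (initial_coloring V E)" "s \<in> set_spmf (pdc_loop V E (\<phi>, 0))"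
      unfolding pdc_def set_bind_spmf by auto
    then have "proper_coloring V E (palette V E) (fst s)"
      by (intro set_pdc_loop) (auto intro: initial_coloring_in_palette)
    then show "case s of (\<phi>, k) \<Rightarrow> proper_coloring V E {1..max_degree V E + 1} \<phi>"
      by (cases s) (simp add: palette_def)
  qed
  have "expected_recolorings V E \<le> ennreal (2 * real (card V) * harm (max_degree V E))"
    by (rule expected_recolorings_le)
  also have "\<dots> \<le> ennreal (2 * real (card V) * ((1 + 1 / ln 2) * ln (real (max 2 (max_degree V E)))))"
    by (intro ennreal_leI mult_left_mono harm_le_ln) auto
  also have "2 * real (card V) * ((1 + 1 / ln 2) * ln (real (max 2 (max_degree V E)))) =
      2 * (1 + 1 / ln 2) * real (card V) * ln (real (max 2 (max_degree V E)))"
  proof -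
    have "a * b * (c * d) = a * c * b * d" for a b c d :: real by simp
    then show ?thesis .
  qed
  finally show "expected_recolorings V E
      \<le> ennreal (2 * (1 + 1 / ln 2) * real (card V) * ln (real (max 2 (max_degree V E))))"
    .
qed

end
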